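(* With $F$ and $H$ the forms defined in the context, where $p=h+3$ and $q=h+4$: for every positive integer $n$ there exist infinitely many integers $h$ such that the system of simultaneous equations $$\begin{aligned} &F^2(x_1,x_2,x_3,x_4)(-x_1^2+3x_2^2+31x_4^2)+h\{F(x_1,x_2,x_3,x_4)+F(x_5,x_6,x_7,x_8)\}H(x_1,\dots,x_8)\\ &\qquad-F^2(x_5,x_6,x_7,x_8)\{x_5-2x_7+2x_8+h(x_6-x_8)\}^2=0,\\ &x_3=0,\\ &x_4=x_2 \end{aligned}$$ has at least $n$ distinct integer solutions $(x_1,\dots,x_8)$ with $(x_1,x_2)\neq(0,0)$ and $(x_5,x_6,x_7,x_8)\neq(0,0,0,0)$. Consequently, for every positive integer $n$ there exist infinitely many integers $h$ such that the single equation of degree 10 in the six variables $x_1,x_2,x_5,x_6,x_7,x_8$ obtained by substituting $x_3=0$, $x_4=x_2$ in the first equation has at least $n$ distinct such integer solutions.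
   Context: Solutions differing by a nonzero rational scalar factor are regarded as equivalent and counted once. For parameters $p,q$, the quartic form $F$ is $$\begin{aligned} F(x_1,x_2,x_3,x_4)={}&x_1^4-2px_1^3x_3+px_1^2x_2^2-(2p^2-4q)x_1^2x_2x_4+(p^2+2q)x_1^2x_3^2+p(p^2-3q)x_1^2x_4^2\\ &-4qx_1x_2^2x_3+4pqx_1x_2x_3x_4-2pqx_1x_3^3-2q(p^2-2q)x_1x_3x_4^2+qx_2^4-2pqx_2^3x_4\\ &+pqx_2^2x_3^2+q(p^2+2q)x_2^2x_4^2-4q^2x_2x_3^2x_4-2pq^2x_2x_4^3+q^2x_3^4+pq^2x_3^2x_4^2+q^3x_4^4 \end{aligned}$$ (the norm of $x_1+x_2\rho+x_3\rho^2+x_4\rho^3$ where $\rho^4+p\rho^2+q=0$). Consider the relations $$\begin{aligned} x_5&=m_1x_1-qm_4x_2-qm_3x_3-q(m_2-pm_4)x_4,\\ x_6&=m_2x_1+m_1x_2-qm_4x_3-qm_3x_4,\\ x_7&=m_3x_1+(m_2-pm_4)x_2+(m_1-pm_3)x_3-\{pm_2-(p^2-q)m_4\}x_4,\\ x_8&=m_4x_1+m_3x_2+(m_2-pm_4)x_3+(m_1-pm_3)x_4. \end{aligned}$$ Viewed as a linear system in $m_1,\dots,m_4$ this is $A\,(m_1,m_2,m_3,m_4)^T=(x_5,x_6,x_7,x_8)^T$ with $$A=\begin{pmatrix}x_1&-qx_4&-qx_3&-qx_2+pqx_4\\ x_2&x_1&-qx_4&-qx_3\\ x_3&x_2-px_4&x_1-px_3&-px_2+(p^2-q)x_4\\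 x_4&x_3&x_2-px_4&x_1-px_3\end{pmatrix},\qquad \det A=F(x_1,x_2,x_3,x_4).$$ The quartic forms $G_1,\dots,G_4$ in $x_1,\dots,x_8$ are those obtained by solving this system, i.e. determined by the identities $G_j(x_1,\dots,x_8)=m_jF(x_1,x_2,x_3,x_4)$, $j=1,2,3,4$, holding identically in $x_1,\dots,x_4,m_1,\dots,m_4$ when $x_5,x_6,x_7,x_8$ are given by $(x_5,x_6,x_7,x_8)^T=A\,(m_1,m_2,m_3,m_4)^T$; equivalently $(G_1,G_2,G_3,G_4)^T=\mathrm{adj}(A)\,(x_5,x_6,x_7,x_8)^T$. Then $$\begin{aligned} H(x_1,\dots,x_8)={}&(-2x_5x_6+3x_6^2+2px_6x_7-3px_6x_8-2qx_7x_8+3qx_8^2)G_1\\ &+(2x_5^2-3x_5x_6-2px_5x_7+3px_5x_8+2qx_7^2-3qx_7x_8)G_2\\ &+2q(x_5x_8-x_6x_7)G_3-3q(x_5x_8-x_6x_7)G_4. \end{aligned}$$ *)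

theory Defs
  imports "Jordan_Normal_Form.Determinant"
begin

text \<open>The norm of \<open>x1 + x2 \<rho> + x3 \<rho>^2 + x4 \<rho>^3\<close>, where \<open>\<rho>^4 + p \<rho>^2 + q = 0\<close>.\<close>

definition F_form :: "'a::comm_ring_1 \<Rightarrow> 'a \<Rightarrow> 'a \<Rightarrow> 'a \<Rightarrow> 'a \<Rightarrow> 'a \<Rightarrow> 'a" where
  "F_form p q x1 x2 x3 x4 =
     x1^4 - 2*p*x1^3*x3 + p*x1^2*x2^2 - (2*p^2 - 4*q)*x1^2*x2*x4
     + (p^2 + 2*q)*x1^2*x3^2 + p*(p^2 - 3*q)*x1^2*x4^2
     - 4*q*x1*x2^2*x3 + 4*p*q*x1*x2*x3*x4 - 2*p*q*x1*x3^3
     - 2*q*(p^2 - 2*q)*x1*x3*x4^2 + q*x2^4 - 2*p*q*x2^3*x4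
     + p*q*x2^2*x3^2 + q*(p^2 + 2*q)*x2^2*x4^2 - 4*q^2*x2*x3^2*x4
     - 2*p*q^2*x2*x4^3 + q^2*x3^4 + p*q^2*x3^2*x4^2 + q^3*x4^4"

definition A_mat :: "'a::comm_ring_1 \<Rightarrow> 'a \<Rightarrow> 'a \<Rightarrow> 'a \<Rightarrow> 'a \<Rightarrow> 'a \<Rightarrow> 'a mat" where
  "A_mat p q x1 x2 x3 x4 = mat_of_rows_list 4
     [[x1, - q*x4,    - q*x3,    - q*x2 + p*q*x4],
      [x2, x1,        - q*x4,    - q*x3],
      [x3, x2 - p*x4, x1 - p*x3, - p*x2 + (p^2 - q)*x4],
      [x4, x3,        x2 - p*x4, x1 - p*x3]]"

text \<open>Vector entries are numbered from 0: the form \<open>G\<^sub>j\<close> is entry \<open>j - 1\<close>.\<close>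

definition G_forms ::
  "'a::comm_ring_1 \<Rightarrow> 'a \<Rightarrow> 'a \<Rightarrow> 'a \<Rightarrow> 'a \<Rightarrow> 'a \<Rightarrow> 'a \<Rightarrow> 'a \<Rightarrow> 'a \<Rightarrow> 'a \<Rightarrow> 'a vec" where
  "G_forms p q x1 x2 x3 x4 x5 x6 x7 x8 =
     adj_mat (A_mat p q x1 x2 x3 x4) *\<^sub>v vec_of_list [x5, x6, x7, x8]"

definition H_form ::
  "'a::comm_ring_1 \<Rightarrow> 'a \<Rightarrow> 'a \<Rightarrow> 'a \<Rightarrow> 'a \<Rightarrow> 'a \<Rightarrow> 'a \<Rightarrow> 'a \<Rightarrow> 'a \<Rightarrow> 'a \<Rightarrow> 'a" where
  "H_form p q x1 x2 x3 x4 x5 x6 x7 x8 =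
     (let G = G_forms p q x1 x2 x3 x4 x5 x6 x7 x8 in
        (- 2*x5*x6 + 3*x6^2 + 2*p*x6*x7 - 3*p*x6*x8 - 2*q*x7*x8 + 3*q*x8^2) * G $ 0
      + (2*x5^2 - 3*x5*x6 - 2*p*x5*x7 + 3*p*x5*x8 + 2*q*x7^2 - 3*q*x7*x8) * G $ 1
      + 2*q*(x5*x8 - x6*x7) * G $ 2
      - 3*q*(x5*x8 - x6*x7) * G $ 3)"

definition Phi ::
  "'a::comm_ring_1 \<Rightarrow> 'a \<Rightarrow> 'a \<Rightarrow> 'a \<Rightarrow> 'a \<Rightarrow> 'a \<Rightarrow> 'a \<Rightarrow> 'a \<Rightarrow> 'a \<Rightarrow> 'a" where
  "Phi h x1 x2 x3 x4 x5 x6 x7 x8 =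
     (let F = F_form (h + 3) (h + 4) in
        (F x1 x2 x3 x4)^2 * (- (x1^2) + 3*x2^2 + 31*x4^2)
      + h * (F x1 x2 x3 x4 + F x5 x6 x7 x8)
          * H_form (h + 3) (h + 4) x1 x2 x3 x4 x5 x6 x7 x8
      - (F x5 x6 x7 x8)^2 * (x5 - 2*x7 + 2*x8 + h*(x6 - x8))^2)"

text \<open>The adjugate gives the forms characterised by \<open>G\<^sub>j = m\<^sub>j F\<close> whenever
  \<open>(x5, x6, x7, x8) = A m\<close>.\<close>

lemma det_mat_Suc:
  fixes f :: "nat \<times> nat \<Rightarrow> 'a::comm_ring_1"
  shows "det (mat (Suc n) (Suc n) f) = (\<Sum>j<Suc n. f (0, j) * (-1)^j *
     det (mat n n (\<lambda>(i,k). f (Suc i, if k < j then k else Suc k))))"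
proof -
  have "mat_delete (mat (Suc n) (Suc n) f) 0 j = mat n n (\<lambda>(i,k). f (Suc i, if k < j then k else Suc k))" for j
    by (rule eq_matI) (auto simp: mat_delete_def)
  then show ?thesis
    by (subst laplace_expansion_row[of _ "Suc n" 0])
       (auto simp: cofactor_def mult.assoc intro!: sum.cong)
qed

lemma det_A_mat: "det (A_mat p q x1 x2 x3 x4) = F_form p q x1 x2 x3 x4"
proof -
  have four: "4 = Suc (Suc (Suc (Suc 0)))" by simp
  have "A_mat p q x1 x2 x3 x4 = mat (Suc (Suc (Suc (Suc 0)))) (Suc (Suc (Suc (Suc 0))))
    (\<lambda>(i, j). [[x1, - q*x4,    - q*x3,    - q*x2 + p*q*x4],
      [x2, x1,        - q*x4,    - q*x3],
      [x3, x2 - p*x4, x1 - p*x3, - p*x2 + (p^2 - q)*x4],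
      [x4, x3,        x2 - p*x4, x1 - p*x3]] ! i ! j)"
    unfolding A_mat_def mat_of_rows_list_def four by (simp only: list.size add_0_right add_Suc_right)
  then show ?thesis
    apply (simp add: det_mat_Suc lessThan_Suc F_form_def)
    apply (simp add: algebra_simps power2_eq_square power3_eq_cube power4_eq_xxxx)
    done
qed

lemma G_forms_characterization:
  assumes "vec_of_list [x5, x6, x7, x8] = A_mat p q x1 x2 x3 x4 *\<^sub>v m" and m: "m \<in> carrier_vec 4"
  shows "G_forms p q x1 x2 x3 x4 x5 x6 x7 x8 = F_form p q x1 x2 x3 x4 \<cdot>\<^sub>v m"
proof -
  let ?A = "A_mat p q x1 x2 x3 x4"
  have A: "?A \<in> carrier_mat 4 4"
    unfolding A_mat_def by (rule carrier_matI) (simp_all add: mat_of_rows_list_def)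
  have "G_forms p q x1 x2 x3 x4 x5 x6 x7 x8 = (adj_mat ?A * ?A) *\<^sub>v m"
    unfolding G_forms_def assms(1) using adj_mat(1)[OF A] A m by simp
  also have "\<dots> = det ?A \<cdot>\<^sub>v m"
    unfolding adj_mat(3)[OF A] using m by (auto simp: det_A_mat)
  finally show ?thesis by (simp add: det_A_mat)
qed

text \<open>Homogeneity of degree 10; scaling by a nonzero factor therefore preserves solutions.\<close>

lemma F_form_scale: "F_form p q (t*x1) (t*x2) (t*x3) (t*x4) = t^4 * F_form p q x1 x2 x3 x4"
  unfolding F_form_def by (simp add: algebra_simps power2_eq_square power3_eq_cube power4_eq_xxxx)

lemma G_forms_scale:
  "G_forms p q (t*x1) (t*x2) (t*x3) (t*x4) (t*x5) (t*x6) (t*x7) (t*x8) =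
   t^4 \<cdot>\<^sub>v G_forms p q x1 x2 x3 x4 x5 x6 x7 x8"
proof -
  let ?A = "A_mat p q x1 x2 x3 x4"
  have A: "?A \<in> carrier_mat 4 4"
    unfolding A_mat_def by (rule carrier_matI) (simp_all add: mat_of_rows_list_def)
  have "A_mat p q (t*x1) (t*x2) (t*x3) (t*x4) = t \<cdot>\<^sub>m ?A"
    by (rule eq_matI)
       (auto simp: A_mat_def mat_of_rows_list_def less_Suc_eq numeral_eq_Suc algebra_simps)
  moreover have "mat_delete (t \<cdot>\<^sub>m ?A) i j = t \<cdot>\<^sub>m mat_delete ?A i j" if "i < 4" "j < 4" for i j
    using A that by (intro eq_matI) (auto simp: mat_delete_def)
  moreover have "mat_delete ?A i j \<in> carrier_mat 3 3" for i j
    using mat_delete_carrier[OF A] by simp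
  ultimately have "adj_mat (A_mat p q (t*x1) (t*x2) (t*x3) (t*x4)) = t^3 \<cdot>\<^sub>m adj_mat ?A"
    using A by (intro eq_matI) (auto simp: adj_mat_def cofactor_def det_smult)
  moreover have "vec_of_list [t*x5, t*x6, t*x7, t*x8] = t \<cdot>\<^sub>v vec_of_list [x5, x6, x7, x8]"
    by (rule eq_vecI) (auto simp: less_Suc_eq)
  moreover have "(t^3 \<cdot>\<^sub>m adj_mat ?A) *\<^sub>v (t \<cdot>\<^sub>v v) = t^4 \<cdot>\<^sub>v (adj_mat ?A *\<^sub>v v)"
    if "v \<in> carrier_vec 4" for v
  proof (rule eq_vecI)
    fix i assume i: "i < dim_vec (t^4 \<cdot>\<^sub>v (adj_mat ?A *\<^sub>v v))"
    then show "((t^3 \<cdot>\<^sub>m adj_mat ?A) *\<^sub>v (t \<cdot>\<^sub>v v)) $ i = (t^4 \<cdot>\<^sub>v (adj_mat ?A *\<^sub>v v)) $ i"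
      using that adj_mat(1)[OF A] by (auto simp: scalar_prod_def sum_distrib_left power4_eq_xxxx power3_eq_cube mult_ac intro!: sum.cong)
  qed simp
  ultimately show ?thesis
    unfolding G_forms_def using carrier_vecI[of "vec_of_list [x5, x6, x7, x8]" 4] by simp
qed

lemma Phi_scale:
  "Phi h (t*x1) (t*x2) (t*x3) (t*x4) (t*x5) (t*x6) (t*x7) (t*x8) =
   t^10 * Phi h x1 x2 x3 x4 x5 x6 x7 x8"
proof -
  have G: "dim_vec (G_forms p q x1 x2 x3 x4 x5 x6 x7 x8) = 4" for p q
    by (simp add: G_forms_def A_mat_def adj_mat_def mat_of_rows_list_def)
  have H: "H_form p q (t*x1) (t*x2) (t*x3) (t*x4) (t*x5) (t*x6) (t*x7) (t*x8) =
    t^6 * H_form p q x1 x2 x3 x4 x5 x6 x7 x8" for p q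
    unfolding H_form_def G_forms_scale Let_def using G[of p q]
    by (simp add: algebra_simps eval_nat_numeral)
  have "t^10 = t^4 * t^6" by (simp flip: power_add)
  then show ?thesis
    unfolding Phi_def H F_form_scale Let_def
    by (simp add: algebra_simps eval_nat_numeral)
qed

definition system_solutions :: "int \<Rightarrow> int list set" where
  "system_solutions h = {[x1, x2, x3, x4, x5, x6, x7, x8] | x1 x2 x3 x4 x5 x6 x7 x8.
     Phi h x1 x2 x3 x4 x5 x6 x7 x8 = 0 \<and> x3 = 0 \<and> x4 = x2 \<and>
     (x1, x2) \<noteq> (0, 0) \<and> (x5, x6, x7, x8) \<noteq> (0, 0, 0, 0)}"

definition single_eq_solutions :: "int \<Rightarrow> int list set" where
  "single_eq_solutions h = {[x1, x2, x5, x6, x7, x8] | x1 x2 x5 x6 x7 x8.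
     Phi h x1 x2 0 x2 x5 x6 x7 x8 = 0 \<and>
     (x1, x2) \<noteq> (0, 0) \<and> (x5, x6, x7, x8) \<noteq> (0, 0, 0, 0)}"

text \<open>Solutions that differ by a nonzero rational factor count once.\<close>

definition proportional :: "int list \<Rightarrow> int list \<Rightarrow> bool" where
  "proportional xs ys \<longleftrightarrow>
     (\<exists>c::rat. c \<noteq> 0 \<and> map rat_of_int ys = map (\<lambda>x. c * rat_of_int x) xs)"

definition at_least_distinct :: "nat \<Rightarrow> int list set \<Rightarrow> bool" where
  "at_least_distinct n X \<longleftrightarrow>
     (\<exists>S. S \<subseteq> X \<and> finite S \<and> card S = n \<and> pairwise (\<lambda>x y. \<not> proportional x y) S)"

end

theory Submission
  imports Defs
begin

text \<open>
Write \<open>f = 1 + \<rho>\<^sup>2\<close>. For \<open>p = h + 3\<close>, \<open>q = h + 4\<close> it satisfies \<open>f\<^sup>2 = - (h + 1) f - 2\<close>, so for large \<open>h\<close>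
the field \<open>K = \<rat>(f)\<close> is quadratic and \<open>L = K(\<rho>)\<close> is quadratic over \<open>K\<close> with \<open>\<rho>\<^sup>2 = f - 1\<close>. Up to scaling, a
vector with \<open>x3 = 0\<close>, \<open>x4 = x2 \<noteq> 0\<close> is \<open>x = t + f \<rho>\<close> with \<open>t\<close> rational; put \<open>y = m x\<close> for
the element \<open>y\<close> with coordinates \<open>x5, ..., x8\<close>. If the relative norm of \<open>m\<close> over \<open>K\<close> is 1,
then both values of \<open>F\<close> agree and the form \<open>H\<close> collapses to \<open>- F\<close> times a linear form in \<open>y\<close>
(\<open>H_cofactor\<close>). The equation then says that the quadratic expression \<open>residual h t y\<close>
vanishes (\<open>Phi_zero\<close>).

The surface cut out in this way carries two rational involutions. With \<open>m\<close> fixed, the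
equation is quadratic in \<open>t\<close>, so \<open>t\<close> can be exchanged with the other root. With \<open>y\<close> fixed,
the equation only sees \<open>t\<^sup>2\<close>, so \<open>t\<close> can be replaced by \<open>- t\<close>; this multiplies \<open>m\<close> by
\<open>(t + f \<rho>) / (- t + f \<rho>)\<close> (\<open>swap_factor\<close>). Applying them in turn from the
solution \<open>m = 1\<close>, \<open>t = 3\<close> yields a sequence of solutions that depend rationally on \<open>h\<close>.

The sequence is shown to consist of different solutions by letting \<open>h\<close> tend to infinity. In
the coordinates of \<open>rescale\<close> multiplication has a simple limit, and four
involutions in a row act on the limit as
\<open>(R, Q) \<mapsto> (R', Q + 8 / (1 + (1 + R')\<^sup>2))\<close> with \<open>R' = R - 4 / (2 Q + 3)\<close>, while \<open>t\<close> tends to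
\<open>2 Q + 3\<close> (\<open>approximated_step\<close>). The limits of \<open>t\<close> therefore increase strictly. Hence for
every \<open>n\<close> and all large integers \<open>h\<close> the first \<open>n\<close> values of \<open>t = x1 / x2\<close> are
different, and clearing denominators gives \<open>n\<close> integer solutions no two of which are
proportional.
\<close>

section \<open>Arithmetic in the quartic field\<close>

text \<open>
The tuple \<open>(a, b, c, e)\<close> stands for \<open>a + b f + (c + e f) \<rho>\<close>; in the basis of powers of
\<open>\<rho>\<close> its coordinates are \<open>a + b, c + e, b, e\<close>. Powers of \<open>f\<close> instead of \<open>\<rho>\<^sup>2\<close> are used
because one conjugate of \<open>f\<close> tends to 0 as \<open>h\<close> grows, which makes the limits below regular.
\<close>

type_synonym elt = "real \<times> real \<times> real \<times> real"

fun mul :: "real \<Rightarrow> elt \<Rightarrow> elt \<Rightarrow> elt" where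
  "mul h (a, b, c, e) (a', b', c', e') =
    (let U = c*c' - 2*e*e'; V = c*e' + e*c' - (h + 1)*e*e' in
     (a*a' - 2*b*b' - U - 2*V, a*b' + b*a' - (h + 1)*b*b' + U - (h + 2)*V,
      a*c' - 2*b*e' + c*a' - 2*e*b',
      a*e' + b*c' - (h + 1)*b*e' + c*b' + e*a' - (h + 1)*e*b'))"

text \<open>The conjugation of \<open>L\<close> over \<open>K\<close>, which sends \<open>\<rho>\<close> to \<open>- \<rho>\<close>.\<close>

fun rel_conj :: "elt \<Rightarrow> elt" where
  "rel_conj (a, b, c, e) = (a, b, - c, - e)"

lemma mul_commute: "mul h m n = mul h n m"
  by (cases m; cases n) (simp add: Let_def algebra_simps)

lemma mul_assoc: "mul h (mul h m n) k = mul h m (mul h n k)"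
  by (cases m; cases n; cases k) (simp add: Let_def algebra_simps)

lemma mul_one: "mul h m (1, 0, 0, 0) = m"
  by (cases m) simp

lemma rel_conj_mul: "rel_conj (mul h m n) = mul h (rel_conj m) (rel_conj n)"
  by (cases m; cases n) (simp add: Let_def algebra_simps)

lemma mul_point: "mul h (a, b, c, e) (t, 0, 0, 1) =
   (a*t + 2*e - 2*(c - (h + 1)*e), b*t - 2*e - (h + 2)*(c - (h + 1)*e),
    c*t - 2*b, a - (h + 1)*b + e*t)"
  by (simp add: Let_def algebra_simps)

text \<open>The linear form whose square multiplies \<open>F\<^sup>2(x5, x6, x7, x8)\<close>: in these coordinates it is
\<open>x5 - 2 x7 + 2 x8 + h (x6 - x8)\<close>.\<close>

fun L_form :: "real \<Rightarrow> elt \<Rightarrow> real" where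
  "L_form h (a, b, c, e) = a - b + 2*e + h*c"

text \<open>For \<open>y = A + B \<rho>\<close> with \<open>A, B \<in> K\<close> and primes for the conjugation of \<open>K\<close>, this is the
coefficient of 1 of \<open>f (2 A' - 3 B')\<close> in the basis \<open>1, \<rho>\<^sup>2\<close>.\<close>

fun H_linear :: "elt \<Rightarrow> real" where
  "H_linear (a, b, c, e) = 2*a + 4*b - 3*c - 6*e"

text \<open>For \<open>y = m (t + f \<rho>)\<close> with \<open>m\<close> of relative norm 1, the form of degree 10 divided by \<open>F\<^sup>2\<close>, at \<open>x1 = t\<close> and \<open>x2 = x4 = 1\<close>; hence \<open>34 = 3 + 31\<close>.\<close>

definition residual :: "real \<Rightarrow> real \<Rightarrow> elt \<Rightarrow> real" where
  "residual h t y = 34 - t^2 - 2*h*H_linear y - (L_form h y)^2"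

text \<open>The norm of \<open>t + f \<rho>\<close> from \<open>L\<close> to \<open>\<rat>\<close>.\<close>

definition base_norm :: "real \<Rightarrow> real \<Rightarrow> real" where
  "base_norm h t = t^4 + (h^3 + 4*h^2 - h - 8)*t^2 + 4*(h + 4)"

text \<open>Transitivity of the norm: \<open>u + v \<rho>\<^sup>2\<close> is the relative norm over \<open>K\<close>, and the right-hand side is
its norm to \<open>\<rat>\<close>.\<close>

lemma F_form_tower:
  fixes p q :: real
  assumes "u = x1^2 - q*x3^2 + 2*q*x2*x4 - p*q*x4^2"
    and "v = 2*x1*x3 - p*x3^2 - x2^2 + 2*p*x2*x4 - (p^2 - q)*x4^2"
  shows "F_form p q x1 x2 x3 x4 = u^2 - p*u*v + q*v^2"
  unfolding F_form_def assms
  by (simp add: algebra_simps power2_eq_square power3_eq_cube power4_eq_xxxx)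

lemma F_form_relative_norm:
  assumes "mul h (a, b, c, e) (rel_conj (a, b, c, e)) = (n0, n1, 0, 0)"
  shows "F_form (h + 3) (h + 4) (a + b) (c + e) b e = n0^2 - (h + 1)*n0*n1 + 2*n1^2"
proof -
  have n: "n0 = a*a - 2*b*b + (c*c - 2*e*e) + 2*(c*e + e*c - (h + 1)*e*e)"
    "n1 = 2*a*b - (h + 1)*b*b - (c*c - 2*e*e) + (h + 2)*(c*e + e*c - (h + 1)*e*e)"
    using assms by (auto simp: Let_def algebra_simps)
  have "F_form (h + 3) (h + 4) (a + b) (c + e) b e
      = (n0 + n1)^2 - (h + 3)*(n0 + n1)*n1 + (h + 4)*n1^2"
    by (rule F_form_tower) (simp_all add: n algebra_simps power2_eq_square)
  then show ?thesis by (simp add: algebra_simps power2_eq_square)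
qed

lemma F_form_base: "F_form (h + 3) (h + 4) t 1 0 1 = base_norm h t"
  unfolding F_form_def base_norm_def
  by (simp add: algebra_simps power2_eq_square power3_eq_cube)

section \<open>The equation for multipliers of relative norm one\<close>

text \<open>Writing \<open>m = c + d \<rho>\<close> and \<open>y = A + B \<rho>\<close> over \<open>K\<close>, the cofactor of \<open>F\<close> in \<open>H\<close> is the coefficient of
1 of \<open>(2 A' - 3 B') (A d - B c)\<close>, primes being conjugates over \<open>\<rat>\<close>. For \<open>y = m (t + f \<rho>)\<close> the
determinant \<open>A d - B c\<close> equals \<open>- f\<close> times the relative norm \<open>n0 + n1 f\<close> of \<open>m\<close>, because
multiplication by \<open>m\<close> changes the determinant of a pair by that norm.\<close>

lemma H_cofactor:
  assumes unit: "mul h (m1, m2, m3, m4) (rel_conj (m1, m2, m3, m4)) = (n0, n1, 0, 0)"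
    and y: "mul h (m1, m2, m3, m4) (t, 0, 0, 1) = (a, b, c, e)"
    and x: "x5 = a + b" "x6 = c + e" "x7 = b" "x8 = e" and pq: "p = h + 3" "q = h + 4"
  shows "(- 2*x5*x6 + 3*x6^2 + 2*p*x6*x7 - 3*p*x6*x8 - 2*q*x7*x8 + 3*q*x8^2) * (m1 + m2)
       + (2*x5^2 - 3*x5*x6 - 2*p*x5*x7 + 3*p*x5*x8 + 2*q*x7^2 - 3*q*x7*x8) * (m3 + m4)
       + 2*q*(x5*x8 - x6*x7) * m2 - 3*q*(x5*x8 - x6*x7) * m4
     = - n0 * H_linear (a, b, c, e)
       - n1 * (2*(2*b - (h + 3)*a) - 3*(2*e - (h + 3)*c))"
proof -
  have n: "n0 = m1*m1 - 2*m2*m2 + (m3*m3 - 2*m4*m4) + 2*(m3*m4 + m4*m3 - (h + 1)*m4*m4)"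
    "n1 = 2*m1*m2 - (h + 1)*m2*m2 - (m3*m3 - 2*m4*m4) + (h + 2)*(m3*m4 + m4*m3 - (h + 1)*m4*m4)"
    using unit by (auto simp: Let_def algebra_simps)
  have abce: "a = m1*t + 2*m4 - 2*(m3 - (h + 1)*m4)"
      "b = m2*t - 2*m4 - (h + 2)*(m3 - (h + 1)*m4)"
      "c = m3*t - 2*m2" "e = m1 - (h + 1)*m2 + m4*t"
    using y unfolding mul_point by auto
  show ?thesis unfolding x pq n abce H_linear.simps
    by (simp add: algebra_simps power2_eq_square)
qed

lemma mul_mul_swap: "mul h (mul h m n) (mul h k l) = mul h (mul h m k) (mul h n l)"
  using mul_assoc mul_commute by metis

lemma A_mat_mult_vec:
  fixes p q t :: real
  shows "A_mat p q t 1 0 1 *\<^sub>v vec_of_list [m1, m2, m3, m4]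
   = vec_of_list [t*m1 - q*m2 + (p*q - q)*m4, m1 + t*m2 - q*m3,
       (1 - p)*m2 + t*m3 + (p^2 - q - p)*m4, m1 + (1 - p)*m3 + t*m4]" (is "?l = vec_of_list ?r")
proof (rule eq_vecI)
  fix i assume "i < dim_vec (vec_of_list ?r)"
  then consider "i = 0" | "i = 1" | "i = 2" | "i = 3" by fastforce
  then show "?l $ i = vec_of_list ?r $ i"
    by cases (simp_all add: A_mat_def mat_of_rows_list_def scalar_prod_def numeral_eq_Suc algebra_simps)
qed (simp add: A_mat_def mat_of_rows_list_def)

text \<open>Relative norm 1 makes the two values of \<open>F\<close> equal, so \<open>F\<^sup>2\<close> splits off from the form of degree 10 and
\<open>residual\<close> remains.\<close>

lemma Phi_zero:
  assumes unit: "mul h m (rel_conj m) = (1, 0, 0, 0)"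
    and y: "mul h m (t, 0, 0, 1) = (a, b, c, e)"
    and res: "residual h t (a, b, c, e) = 0"
  shows "F_form (h + 3) (h + 4) (a + b) (c + e) b e = base_norm h t"
    and "Phi h t 1 0 1 (a + b) (c + e) b e = 0"
proof -
  obtain m1 m2 m3 m4 where m: "m = (m1, m2, m3, m4)" by (cases m) auto
  let ?v = "vec_of_list [m1 + m2, m3 + m4, m2, m4]"
  let ?H = "H_form (h + 3) (h + 4) t 1 0 1 (a + b) (c + e) b e"
  have x: "mul h (t, 0, 0, 1) (rel_conj (t, 0, 0, 1)) = (t^2 - (2*h + 4), - (h^2 + 3*h), 0, 0)"
    by (simp add: Let_def algebra_simps power2_eq_square)
  have "mul h (a, b, c, e) (rel_conj (a, b, c, e))
      = mul h (mul h m (rel_conj m)) (mul h (t, 0, 0, 1) (rel_conj (t, 0, 0, 1)))"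
    unfolding y[symmetric] rel_conj_mul by (rule mul_mul_swap)
  also have "\<dots> = (t^2 - (2*h + 4), - (h^2 + 3*h), 0, 0)"
    unfolding unit x by (simp only: mul_commute[of h "(1,0,0,0)"] mul_one)
  finally show Fy: "F_form (h + 3) (h + 4) (a + b) (c + e) b e = base_norm h t"
    by (subst F_form_relative_norm)
       (assumption, simp add: base_norm_def algebra_simps power2_eq_square power3_eq_cube power4_eq_xxxx)
  have abce: "a = m1*t + 2*m4 - 2*(m3 - (h + 1)*m4)"
      "b = m2*t - 2*m4 - (h + 2)*(m3 - (h + 1)*m4)"
      "c = m3*t - 2*m2" "e = m1 - (h + 1)*m2 + m4*t"
    using y unfolding m mul_point by auto
  have "vec_of_list [a + b, c + e, b, e] = A_mat (h + 3) (h + 4) t 1 0 1 *\<^sub>v ?v"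
    unfolding A_mat_mult_vec abce by (simp add: algebra_simps power2_eq_square)
  then have G: "G_forms (h + 3) (h + 4) t 1 0 1 (a + b) (c + e) b e = base_norm h t \<cdot>\<^sub>v ?v"
    unfolding F_form_base[symmetric] by (rule G_forms_characterization) (auto intro: carrier_vecI)
  have factor: "k1*(r*v1) + k2*(r*v2) + k3*(r*v3) - k4*(r*v4) = r*(k1*v1 + k2*v2 + k3*v3 - k4*v4)"
    for k1 k2 k3 k4 r v1 v2 v3 v4 :: real
    by (simp add: algebra_simps)
  have entries: "(base_norm h t \<cdot>\<^sub>v ?v) $ 0 = base_norm h t * (m1 + m2)" "(base_norm h t \<cdot>\<^sub>v ?v) $ 1 = base_norm h t * (m3 + m4)"
    "(base_norm h t \<cdot>\<^sub>v ?v) $ 2 = base_norm h t * m2" "(base_norm h t \<cdot>\<^sub>v ?v) $ 3 = base_norm h t * m4"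
    by (simp_all add: numeral_eq_Suc)
  have H: "?H = base_norm h t * (- H_linear (a, b, c, e))"
    unfolding H_form_def G Let_def entries factor
      H_cofactor[OF unit[unfolded m] y[unfolded m] refl refl refl refl refl refl] by simp
  have L: "(a + b) - 2*b + 2*e + h*((c + e) - e) = L_form h (a, b, c, e)" by simp
  have "Phi h t 1 0 1 (a + b) (c + e) b e = (base_norm h t)^2 * residual h t (a, b, c, e)"
    unfolding Phi_def Let_def Fy F_form_base H L residual_def
    by (simp add: algebra_simps power2_eq_square)
  then show "Phi h t 1 0 1 (a + b) (c + e) b e = 0" using res by simp
qed

section \<open>The two involutions\<close>

lemma mul_point_divide: "mul h (a/n, b/n, c/n, e/n) (t, 0, 0, 1) =
   ((a*t + 2*e - 2*(c - (h + 1)*e))/n, (b*t - 2*e - (h + 2)*(c - (h + 1)*e))/n,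
    (c*t - 2*b)/n, (a - (h + 1)*b + e*t)/n)"
  unfolding mul_point prod.inject
  by (intro conjI) (simp_all add: diff_divide_distrib add_divide_distrib algebra_simps)

text \<open>The quotient \<open>(t + f \<rho>) / (- t + f \<rho>)\<close>, made explicit by multiplying with the conjugate of the
denominator over \<open>K\<close> and inverting the relative norm in \<open>K\<close>.\<close>

definition swap_factor :: "real \<Rightarrow> real \<Rightarrow> elt" where
  "swap_factor h t =
    (- (t^4 + (h + 1)*(h^2 + 3*h)*t^2 - 4*(h + 4)) / base_norm h t, - 2*t^2*(h^2 + 3*h) / base_norm h t,
     4*t*(h^2 + 3*h) / base_norm h t, - 2*t*(t^2 - (2*h + 4)) / base_norm h t)"

lemma swap_factor_mul:
  assumes "base_norm h t \<noteq> 0"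
  shows "mul h (swap_factor h t) (- t, 0, 0, 1) = (t, 0, 0, 1)"
proof -
  let ?a = "- (t^4 + (h + 1)*(h^2 + 3*h)*t^2 - 4*(h + 4))" and ?b = "- 2*t^2*(h^2 + 3*h)"
    and ?c = "4*t*(h^2 + 3*h)" and ?e = "- 2*t*(t^2 - (2*h + 4))"
  have 2: "?a*(- t) + 2*?e - 2*(?c - (h + 1)*?e) = t * base_norm h t"
    "?b*(- t) - 2*?e - (h + 2)*(?c - (h + 1)*?e) = 0" "?c*(- t) - 2*?b = 0"
    "?a - (h + 1)*?b + ?e*(- t) = base_norm h t"
    by (simp_all add: base_norm_def algebra_simps power2_eq_square power3_eq_cube power4_eq_xxxx)
  show ?thesis
    unfolding swap_factor_def mul_point_divide 2 using assms by simp
qed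

lemma relative_norm_in_base: "\<exists>n0 n1. mul h m (rel_conj m) = (n0, n1, 0, 0)"
  by (cases m) (simp add: Let_def)

lemma mul_point_cancel:
  assumes "mul h (n0, n1, 0, 0) (t, 0, 0, 1) = (t, 0, 0, 1)"
  shows "n0 = 1 \<and> n1 = 0"
  using assms unfolding mul_point by auto

text \<open>A quotient of two elements with the same relative norm. Conjugating
\<open>swap_factor_mul\<close> shows that multiplication by the conjugate sends \<open>t + f \<rho>\<close> to \<open>- t + f \<rho>\<close>,
so the relative norm fixes \<open>t + f \<rho>\<close>.\<close>

lemma swap_factor_unit:
  assumes "base_norm h t \<noteq> 0"
  shows "mul h (swap_factor h t) (rel_conj (swap_factor h t)) = (1, 0, 0, 0)"
proof -
  let ?j = "swap_factor h t"
  obtain a b c e where cj: "rel_conj ?j = (a, b, c, e)" by (cases "rel_conj ?j") auto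
  have "rel_conj (mul h ?j (- t, 0, 0, 1)) = rel_conj (t, 0, 0, 1)"
    by (simp only: swap_factor_mul[OF assms])
  then have "mul h (rel_conj ?j) (- t, 0, 0, - 1) = (t, 0, 0, - 1)"
    by (simp only: rel_conj_mul) (simp add: cj)
  then have "mul h (rel_conj ?j) (t, 0, 0, 1) = (- t, 0, 0, 1)"
    unfolding cj by (simp add: Let_def algebra_simps)
  then have fp: "mul h (mul h ?j (rel_conj ?j)) (t, 0, 0, 1) = (t, 0, 0, 1)"
    by (simp only: mul_assoc swap_factor_mul[OF assms])
  obtain n0 n1 where n: "mul h ?j (rel_conj ?j) = (n0, n1, 0, 0)"
    using relative_norm_in_base by blast
  show ?thesis using mul_point_cancel[OF fp[unfolded n]] unfolding n by simp
qed

fun rational :: "elt \<Rightarrow> bool" where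
  "rational (a, b, c, e) \<longleftrightarrow> a \<in> \<rat> \<and> b \<in> \<rat> \<and> c \<in> \<rat> \<and> e \<in> \<rat>"

lemma rational_mul: "h \<in> \<rat> \<Longrightarrow> rational m \<Longrightarrow> rational n \<Longrightarrow> rational (mul h m n)"
  by (cases m; cases n; simp only: mul.simps Let_def rational.simps; elim conjE;
      intro conjI Rats_add Rats_diff Rats_mult Rats_1 Rats_number_of; assumption)

lemma rational_base_norm: "h \<in> \<rat> \<Longrightarrow> t \<in> \<rat> \<Longrightarrow> base_norm h t \<in> \<rat>"
  unfolding base_norm_def
  by (intro Rats_add Rats_diff Rats_mult Rats_power Rats_number_of; assumption)

lemma rational_swap_factor: "h \<in> \<rat> \<Longrightarrow> t \<in> \<rat> \<Longrightarrow> rational (swap_factor h t)"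
  unfolding swap_factor_def rational.simps
  by (intro conjI Rats_divide Rats_minus_iff[THEN iffD2] Rats_add Rats_diff Rats_mult Rats_power
      Rats_number_of Rats_1 rational_base_norm; assumption)

definition admissible :: "real \<Rightarrow> elt \<Rightarrow> real \<Rightarrow> bool" where
  "admissible h m t \<longleftrightarrow> rational m \<and> t \<in> \<rat> \<and> mul h m (rel_conj m) = (1, 0, 0, 0) \<and>
     residual h t (mul h m (t, 0, 0, 1)) = 0"

text \<open>The involution with \<open>y\<close> fixed: the new multiplier gives the same \<open>y\<close> for \<open>- t\<close>.\<close>

lemma admissible_swap:
  assumes "admissible h m t" "h \<in> \<rat>" "base_norm h t \<noteq> 0"
  shows "admissible h (mul h m (swap_factor h t)) (- t)"
proof -
  have "mul h (mul h m (swap_factor h t)) (- t, 0, 0, 1) = mul h m (t, 0, 0, 1)"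
    by (simp only: mul_assoc swap_factor_mul[OF assms(3)])
  moreover have "residual h (- t) y = residual h t y" for y
    by (simp add: residual_def)
  moreover have "mul h (mul h m (swap_factor h t)) (rel_conj (mul h m (swap_factor h t))) = (1, 0, 0, 0)"
    unfolding rel_conj_mul mul_mul_swap[of h m "swap_factor h t" "rel_conj m"] swap_factor_unit[OF assms(3)] mul_one
    using assms(1) by (simp add: admissible_def)
  ultimately show ?thesis
    using assms by (simp add: admissible_def rational_mul rational_swap_factor)
qed

definition quad_lead :: "real \<Rightarrow> elt \<Rightarrow> real" where
  "quad_lead h m = 1 + (L_form h m)^2"

definition quad_mid :: "real \<Rightarrow> elt \<Rightarrow> real" where
  "quad_mid h m = 2*h*H_linear m + 2 * L_form h m * L_form h (mul h m (0, 0, 0, 1))"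

definition quad_const :: "real \<Rightarrow> elt \<Rightarrow> real" where
  "quad_const h m = 34 - 2*h*H_linear (mul h m (0, 0, 0, 1)) - (L_form h (mul h m (0, 0, 0, 1)))^2"

lemma quad_lead_pos: "quad_lead h m > 0"
  unfolding quad_lead_def by (simp add: add_pos_nonneg)

lemma residual_quadratic:
  "residual h t (mul h m (t, 0, 0, 1)) = quad_const h m - quad_mid h m * t - quad_lead h m * t^2"
proof -
  have "L_form h (mul h m (t, 0, 0, 1)) = t * L_form h m + L_form h (mul h m (0, 0, 0, 1))"
    "H_linear (mul h m (t, 0, 0, 1)) = t * H_linear m + H_linear (mul h m (0, 0, 0, 1))"
    by (cases m; simp only: mul_point; simp add: algebra_simps)+
  then show ?thesis
    unfolding residual_def quad_const_def quad_mid_def quad_lead_def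
    by (simp add: algebra_simps power2_eq_square)
qed

lemma rational_coeffs:
  assumes "h \<in> \<rat>" "rational m"
  shows "quad_lead h m \<in> \<rat>" "quad_mid h m \<in> \<rat>" "quad_const h m \<in> \<rat>"
  using assms unfolding quad_lead_def quad_mid_def quad_const_def
  by (cases m; simp only: mul_point; simp)+

text \<open>The involution with \<open>m\<close> fixed, by the formula for the sum of the roots.\<close>

lemma admissible_other_root:
  assumes "admissible h m t" "h \<in> \<rat>"
  shows "admissible h m (- t - quad_mid h m / quad_lead h m)"
proof -
  let ?l = "quad_lead h m" and ?b = "quad_mid h m"
  have "quad_const h m - ?b*(- t - ?b/?l) - ?l*(- t - ?b/?l)^2 = quad_const h m - ?b*t - ?l*t^2"
    using quad_lead_pos[of h m] by (simp add: field_simps power2_eq_square)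
  then show ?thesis
    using assms by (simp add: admissible_def residual_quadratic rational_coeffs)
qed

text \<open>The same involution by the formula for the product of the roots. When the known root is of order
\<open>h\<close> and the other one stays bounded, the sum of the roots loses the limit through cancellation
and the product does not.\<close>

lemma admissible_root_product:
  assumes "admissible h m t" "h \<in> \<rat>" "t \<noteq> 0"
  shows "admissible h m (- quad_const h m / (quad_lead h m * t))"
proof -
  have "quad_const h m = quad_mid h m * t + quad_lead h m * t^2"
    using assms(1) by (simp add: admissible_def residual_quadratic)
  then have "- quad_const h m / (quad_lead h m * t) = - t - quad_mid h m / quad_lead h m"
    using quad_lead_pos[of h m] assms(3) by (simp add: field_simps power2_eq_square)
  then show ?thesis using admissible_other_root[OF assms(1,2)] by simp
qed

section \<open>The limit of large parameters\<close>

text \<open>The powers of \<open>h\<close> compensate the decay of the coordinates of the multipliers along the sequence of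
solutions, so that the rescaled multipliers converge.\<close>

fun rescale :: "real \<Rightarrow> elt \<Rightarrow> elt" where
  "rescale h (a, b, c, e) = (a, h*b, h*c, h^2*e)"

text \<open>Multiplication in rescaled coordinates, with \<open>d = 1/h\<close>. It is polynomial in \<open>d\<close> and hence continuous at
\<open>d = 0\<close>; this is what allows passing to the limit.\<close>

definition rescaled_mul :: "real \<Rightarrow> elt \<Rightarrow> elt \<Rightarrow> elt" where
  "rescaled_mul d m n =
    (case m of (u, v, w, z) \<Rightarrow> case n of (u', v', w', z') \<Rightarrow>
      let X = w*z' + z*w' - (1 + d)*z*z'; Y = d^2*w*w' - 2*d^4*z*z' in
      (u*u' - 2*d^2*v*v' - Y - 2*d^3*X,
       u*v' + v*u' - (1 + d)*v*v' + d*w*w' - 2*d^3*z*z' - d*(1 + 2*d)*X,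
       u*w' + w*u' - 2*d^2*(v*z' + z*v'),
       u*z' + v*w' - (1 + d)*v*z' + u'*z + v'*w - (1 + d)*z*v'))"

lemma rescale_mul:
  assumes "h \<noteq> 0"
  shows "rescale h (mul h m n) = rescaled_mul (1/h) (rescale h m) (rescale h n)"
proof -
  define g where "g = 1/h"
  have g: "g * h = 1" "g * (h * x) = x" for x
    using assms by (simp_all add: g_def)
  obtain a b c e where m: "m = (a, b, c, e)" by (cases m) auto
  obtain a' b' c' e' where n: "n = (a', b', c', e')" by (cases n) auto
  show ?thesis
    unfolding g_def[symmetric] m n
    by (simp add: rescaled_mul_def Let_def algebra_simps power2_eq_square power3_eq_cube power4_eq_xxxx g)
qed

lemma tendsto_rescaled_mul:
  assumes "(X \<longlongrightarrow> x) F" "(Y \<longlongrightarrow> y) F" "(d \<longlongrightarrow> 0) F"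
  shows "((\<lambda>i. rescaled_mul (d i) (X i) (Y i)) \<longlongrightarrow> rescaled_mul 0 x y) F"
  unfolding rescaled_mul_def Let_def split_beta by (intro tendsto_intros assms)

lemma tendsto_large_index:
  fixes f g :: "nat \<Rightarrow> 'a::topological_space"
  assumes "f \<longlonglongrightarrow> a" "\<And>i. i \<ge> 2 \<Longrightarrow> f i = g i" "a = b"
  shows "g \<longlonglongrightarrow> b"
  using assms Lim_transform_eventually[of f a sequentially g]
  by (auto simp: eventually_sequentially)

lemma forms_rescale:
  assumes "h \<noteq> 0"
  shows "L_form h m = (case rescale h m of (u, v, w, z) \<Rightarrow> u - (1/h)*v + 2*(1/h)^2*z + w)"
    and "H_linear m = (case rescale h m of (u, v, w, z) \<Rightarrow> 2*u + 4*(1/h)*v - 3*(1/h)*w - 6*(1/h)^2*z)"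
    and "L_form h (mul h m (0, 0, 0, 1)) = (case rescale h m of (u, v, w, z) \<Rightarrow>
           w - (1 + 1/h - 4*(1/h)^2)*z + 2*u - (4 + 2*(1/h))*v)"
    and "H_linear (mul h m (0, 0, 0, 1)) = (case rescale h m of (u, v, w, z) \<Rightarrow>
           - (4 + 12*(1/h))*w + (4 + 16*(1/h) + 8*(1/h)^2)*z - 6*u + (6 + 12*(1/h))*v)"
  using assms
  by (cases m; simp only: mul_point rescale.simps L_form.simps H_linear.simps prod.case;
      simp add: field_simps power2_eq_square)+

lemma quadratic_limits:
  assumes m: "(\<lambda>i. rescale (real i) (m i)) \<longlonglongrightarrow> (u, v, w, z)"
  shows "(\<lambda>i. quad_lead (real i) (m i)) \<longlonglongrightarrow> 1 + (u + w)^2"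
    and "(\<lambda>i. quad_mid (real i) (m i) / real i) \<longlonglongrightarrow> 4*u"
    and "(\<lambda>i. quad_const (real i) (m i) / real i) \<longlonglongrightarrow> 8*(w - z) + 12*(u - v)"
proof -
  let ?X = "\<lambda>i. rescale (real i) (m i)" and ?r = "\<lambda>i. mul (real i) (m i) (0, 0, 0, 1)"
  have d: "(\<lambda>i. 1 / real i) \<longlonglongrightarrow> 0" by (rule lim_1_over_n)
  have "(\<lambda>i. case ?X i of (u, v, w, z) \<Rightarrow> u - (1/real i)*v + 2*(1/real i)^2*z + w)
      \<longlonglongrightarrow> (case (u, v, w, z) of (u, v, w, z) \<Rightarrow> u - 0*v + 2*0^2*z + w)"
    unfolding split_beta by (intro tendsto_intros m d)
  then have L_form: "(\<lambda>i. L_form (real i) (m i)) \<longlonglongrightarrow> u + w"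
    by (rule tendsto_large_index)
       (simp_all add: forms_rescale(1))
  have H_linear: "H_linear (m i) = (case ?X i of (u, v, w, z) \<Rightarrow>
      2*u + 4*(1/real i)*v - 3*(1/real i)*w - 6*(1/real i)^2*z)" if "i \<ge> 2" for i
    using forms_rescale(2)[of "real i"] that by simp
  have "(\<lambda>i. case ?X i of (u, v, w, z) \<Rightarrow> 2*u + 4*(1/real i)*v - 3*(1/real i)*w - 6*(1/real i)^2*z)
      \<longlonglongrightarrow> (case (u, v, w, z) of (u, v, w, z) \<Rightarrow> 2*u + 4*0*v - 3*0*w - 6*0^2*z)"
    unfolding split_beta by (intro tendsto_intros m d)
  then have H_linear: "(\<lambda>i. H_linear (m i)) \<longlonglongrightarrow> 2*u"
    by (rule tendsto_large_index)
       (simp_all add: H_linear)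
  have "(\<lambda>i. case ?X i of (u, v, w, z) \<Rightarrow>
           w - (1 + 1/real i - 4*(1/real i)^2)*z + 2*u - (4 + 2*(1/real i))*v)
      \<longlonglongrightarrow> (case (u, v, w, z) of (u, v, w, z) \<Rightarrow> w - (1 + 0 - 4*0^2)*z + 2*u - (4 + 2*0)*v)"
    unfolding split_beta by (intro tendsto_intros m d)
  then have lamr: "(\<lambda>i. L_form (real i) (?r i)) \<longlonglongrightarrow> w - z + 2*u - 4*v"
    by (rule tendsto_large_index)
       (simp_all add: forms_rescale(3))
  have "(\<lambda>i. case ?X i of (u, v, w, z) \<Rightarrow>
           - (4 + 12*(1/real i))*w + (4 + 16*(1/real i) + 8*(1/real i)^2)*z - 6*u + (6 + 12*(1/real i))*v)
      \<longlonglongrightarrow> (case (u, v, w, z) of (u, v, w, z) \<Rightarrow>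
           - (4 + 12*0)*w + (4 + 16*0 + 8*0^2)*z - 6*u + (6 + 12*0)*v)"
    unfolding split_beta by (intro tendsto_intros m d)
  then have ellr: "(\<lambda>i. H_linear (?r i)) \<longlonglongrightarrow> - 4*w + 4*z - 6*u + 6*v"
    by (rule tendsto_large_index)
       (simp_all add: forms_rescale(4))
  show "(\<lambda>i. quad_lead (real i) (m i)) \<longlonglongrightarrow> 1 + (u + w)^2"
    unfolding quad_lead_def by (intro tendsto_intros L_form)
  have "(\<lambda>i. 2*H_linear (m i) + 2*L_form (real i) (m i)*L_form (real i) (?r i)*(1/real i))
      \<longlonglongrightarrow> 2*(2*u) + 2*(u + w)*(w - z + 2*u - 4*v)*0"
    by (intro tendsto_intros L_form H_linear lamr d)
  then show "(\<lambda>i. quad_mid (real i) (m i) / real i) \<longlonglongrightarrow> 4*u"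
    by (rule tendsto_large_index)
       (simp_all add: quad_mid_def field_simps)
  have "(\<lambda>i. 34*(1/real i) - 2*H_linear (?r i) - (L_form (real i) (?r i))^2*(1/real i))
      \<longlonglongrightarrow> 34*0 - 2*(- 4*w + 4*z - 6*u + 6*v) - (w - z + 2*u - 4*v)^2*0"
    by (intro tendsto_intros lamr ellr d)
  then show "(\<lambda>i. quad_const (real i) (m i) / real i) \<longlonglongrightarrow> 8*(w - z) + 12*(u - v)"
    by (rule tendsto_large_index)
       (simp_all add: quad_const_def field_simps)
qed

lemma base_norm_pos:
  assumes "h \<ge> 2"
  shows "base_norm h t > 0"
proof -
  have four: "h^2 \<ge> 4" using power_mono[of 2 h 2] assms by simp
  then have "h*h^2 \<ge> h*4" using assms by (intro mult_left_mono) auto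
  then have "h^3 \<ge> 4*h" by (simp add: power3_eq_cube power2_eq_square mult.commute)
  with four have "h^3 + 4*h^2 - h - 8 \<ge> 0" using assms by linarith
  then show ?thesis unfolding base_norm_def using assms by (intro add_nonneg_pos add_nonneg_nonneg) auto
qed

text \<open>Numerators and denominator are divided by \<open>h\<^sup>3\<close>, the order of the norm of \<open>t + f \<rho>\<close> for bounded \<open>t\<close>.\<close>

lemma swap_factor_limit_small:
  assumes t: "t \<longlonglongrightarrow> \<tau>" and "\<tau> \<noteq> 0"
  shows "(\<lambda>i. rescale (real i) (swap_factor (real i) (t i))) \<longlonglongrightarrow> (- 1, - 2, 4/\<tau>, 4/\<tau>)"
proof -
  have d: "(\<lambda>i. 1 / real i) \<longlonglongrightarrow> 0" by (rule lim_1_over_n)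
  define n where "n d t = d^3*t^4 + (1 + 4*d - d^2 - 8*d^3)*t^2 + 4*d^2 + 16*d^3" for d t :: real
  define A where "A d t = - (d^3*t^4 + (1 + d)*(1 + 3*d)*t^2 - 4*d^2 - 16*d^3) / n d t" for d t :: real
  define B where "B d t = - 2*t^2*(1 + 3*d) / n d t" for d t :: real
  define C where "C d t = 4*t*(1 + 3*d) / n d t" for d t :: real
  define E where "E d t = - 2*t*(d*t^2 - 2 - 4*d) / n d t" for d t :: real
  have n: "base_norm (real i) (t i) = real i ^ 3 * n (1/real i) (t i)" if "i > 0" for i
    using that by (simp add: n_def base_norm_def field_simps power2_eq_square power3_eq_cube)
  have eq: "rescale (real i) (swap_factor (real i) (t i))
      = (A (1/real i) (t i), B (1/real i) (t i), C (1/real i) (t i), E (1/real i) (t i))"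
    if "i \<ge> 2" for i
  proof -
    have "base_norm (real i) (t i) > 0" using that by (intro base_norm_pos) simp
    then have nz: "n (1/real i) (t i) \<noteq> 0" using n[of i] that by auto
    then show ?thesis
      unfolding swap_factor_def rescale.simps A_def B_def C_def E_def using that
      by (simp add: n) (simp add: field_simps power2_eq_square power3_eq_cube power4_eq_xxxx)
  qed
  have nl: "(\<lambda>i. n (1/real i) (t i)) \<longlonglongrightarrow> 0^3*\<tau>^4 + (1 + 4*0 - 0^2 - 8*0^3)*\<tau>^2 + 4*0^2 + 16*0^3"
    unfolding n_def by (intro tendsto_intros t d)
  then have nl: "(\<lambda>i. n (1/real i) (t i)) \<longlonglongrightarrow> \<tau>^2" by simp
  have nz: "\<tau>^2 \<noteq> 0" using assms by simp
  have "(\<lambda>i. (A (1/real i) (t i), B (1/real i) (t i), C (1/real i) (t i), E (1/real i) (t i)))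
     \<longlonglongrightarrow> (- (0^3*\<tau>^4 + (1 + 0)*(1 + 3*0)*\<tau>^2 - 4*0^2 - 16*0^3) / \<tau>^2, - 2*\<tau>^2*(1 + 3*0) / \<tau>^2,
          4*\<tau>*(1 + 3*0) / \<tau>^2, - 2*\<tau>*(0*\<tau>^2 - 2 - 4*0) / \<tau>^2)"
    unfolding A_def B_def C_def E_def by (intro tendsto_intros t d nl nz)
  then show ?thesis
    by (rule tendsto_large_index)
       (use assms in \<open>simp_all add: eq power2_eq_square\<close>)
qed

text \<open>For \<open>t\<close> of order \<open>h\<close> the norm of \<open>t + f \<rho>\<close> has order \<open>h\<^sup>5\<close>.\<close>

lemma swap_factor_limit_large:
  assumes t: "(\<lambda>i. t i / real i) \<longlonglongrightarrow> \<theta>" and "\<theta> \<noteq> 0"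
  shows "(\<lambda>i. rescale (real i) (swap_factor (real i) (t i))) \<longlonglongrightarrow> (- 1, - 2, 0, - 2*\<theta>)"
proof -
  have d: "(\<lambda>i. 1 / real i) \<longlonglongrightarrow> 0" by (rule lim_1_over_n)
  define n where "n d t = d*t^4 + (1 + 4*d - d^2 - 8*d^3)*t^2 + 4*d^4 + 16*d^5" for d t :: real
  define A where "A d t = - (d*t^4 + (1 + d)*(1 + 3*d)*t^2 - 4*d^4 - 16*d^5) / n d t" for d t :: real
  define B where "B d t = - 2*t^2*(1 + 3*d) / n d t" for d t :: real
  define C where "C d t = 4*t*(1 + 3*d)*d / n d t" for d t :: real
  define E where "E d t = - 2*t*(t^2 - 2*d - 4*d^2) / n d t" for d t :: real
  have n: "base_norm h (h*x) = h ^ 5 * n (1/h) x" if "h > 0" for h x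
    using that by (simp add: n_def base_norm_def field_simps eval_nat_numeral)
  have eq': "rescale h (swap_factor h (h*x)) = (A (1/h) x, B (1/h) x, C (1/h) x, E (1/h) x)"
    if "h \<ge> 2" for h x
  proof -
    have "base_norm h (h*x) > 0" using that by (intro base_norm_pos) simp
    then have nz: "n (1/h) x \<noteq> 0" using n[of h x] that by auto
    then show ?thesis
      unfolding swap_factor_def rescale.simps A_def B_def C_def E_def using that
      by (simp add: n) (simp add: field_simps eval_nat_numeral)
  qed
  have eq: "rescale (real i) (swap_factor (real i) (t i))
      = (A (1/real i) (t i/real i), B (1/real i) (t i/real i), C (1/real i) (t i/real i), E (1/real i) (t i/real i))"
    if "i \<ge> 2" for i
    using eq'[of "real i" "t i / real i"] that by simp
  have nl: "(\<lambda>i. n (1/real i) (t i/real i)) \<longlonglongrightarrow> 0*\<theta>^4 + (1 + 4*0 - 0^2 - 8*0^3)*\<theta>^2 + 4*0^4 + 16*0^5"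
    unfolding n_def by (intro tendsto_intros t d)
  then have nl: "(\<lambda>i. n (1/real i) (t i/real i)) \<longlonglongrightarrow> \<theta>^2" by simp
  have nz: "\<theta>^2 \<noteq> 0" using assms by simp
  have "(\<lambda>i. (A (1/real i) (t i/real i), B (1/real i) (t i/real i), C (1/real i) (t i/real i), E (1/real i) (t i/real i)))
     \<longlonglongrightarrow> (- (0*\<theta>^4 + (1 + 0)*(1 + 3*0)*\<theta>^2 - 4*0^4 - 16*0^5) / \<theta>^2, - 2*\<theta>^2*(1 + 3*0) / \<theta>^2,
          4*\<theta>*(1 + 3*0)*0 / \<theta>^2, - 2*\<theta>*(\<theta>^2 - 2*0 - 4*0^2) / \<theta>^2)"
    unfolding A_def B_def C_def E_def by (intro tendsto_intros t d nl nz)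
  then show ?thesis
    by (rule tendsto_large_index)
       (use assms in \<open>simp_all add: eq\<close>)
qed

section \<open>The limiting orbit\<close>

fun limit_step :: "real \<times> real \<Rightarrow> real \<times> real" where
  "limit_step (R, Q) = (let R' = R - 4/(2*Q + 3) in (R', Q + 8/(1 + (1 + R')^2)))"

text \<open>The limit multiplier \<open>(1, 0, R, R - Q)\<close> is written with \<open>R\<close> and \<open>Q\<close> since these are the limits of
\<open>h\<close> times the \<open>\<rho>\<close>-coefficient at the two real embeddings of \<open>K\<close>, normalised by the coefficient of 1;
both are additive under multiplication.\<close>

definition approximated :: "real \<times> real \<Rightarrow> bool" where
  "approximated P \<longleftrightarrow> (\<exists>m t. (\<forall>\<^sub>F i in sequentially. admissible (real i) (m i) (t i)) \<and>
     (\<lambda>i. rescale (real i) (m i)) \<longlonglongrightarrow> (1, 0, fst P, fst P - snd P) \<and>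
     t \<longlonglongrightarrow> 2 * snd P + 3)"

lemma rescale_mul_limit:
  assumes "(\<lambda>i. rescale (real i) (m i)) \<longlonglongrightarrow> x" "(\<lambda>i. rescale (real i) (n i)) \<longlonglongrightarrow> y"
  shows "(\<lambda>i. rescale (real i) (mul (real i) (m i) (n i))) \<longlonglongrightarrow> rescaled_mul 0 x y"
  by (rule tendsto_large_index[OF tendsto_rescaled_mul[OF assms lim_1_over_n]]) (simp_all add: rescale_mul)

text \<open>Starting from a bounded root, the four involutions lead through a root \<open>t\<close> with
\<open>t / h\<close> tending to \<open>\<theta> > 0\<close> back to a bounded one. The first change of sign subtracts \<open>4 / \<tau>\<close> from \<open>R\<close>,
where \<open>\<tau>\<close> is the limit of the bounded root, the second one adds \<open>2 \<theta>\<close> to \<open>Q\<close>.\<close>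

lemma approximated_step:
  assumes "approximated (R, Q)" "Q \<ge> 0"
  shows "approximated (limit_step (R, Q))"
proof -
  obtain m s where ev: "\<forall>\<^sub>F i in sequentially. admissible (real i) (m i) (s i)"
    and m: "(\<lambda>i. rescale (real i) (m i)) \<longlonglongrightarrow> (1, 0, R, R - Q)"
    and s: "s \<longlonglongrightarrow> 2*Q + 3"
    using assms(1) unfolding approximated_def by auto
  define \<tau> where "\<tau> = 2*Q + 3"
  define R' where "R' = R - 4/\<tau>"
  \<comment> \<open>The limit of \<open>t / h\<close> for the large root: minus the linear by the leading coefficient of the
    quadratic equation for the intermediate multiplier.\<close>
  define \<theta> where "\<theta> = 4/(1 + (1 + R')^2)"
  have \<tau>: "\<tau> \<noteq> 0" using assms(2) by (simp add: \<tau>_def)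
  have den: "1 + (1 + R')^2 > 0" by (simp add: add_pos_nonneg)
  then have \<theta>: "\<theta> \<noteq> 0" by (simp add: \<theta>_def)
  have step: "limit_step (R, Q) = (R', Q + 2*\<theta>)"
    by (simp add: Let_def R'_def \<theta>_def \<tau>_def)
  define m1 where "m1 i = mul (real i) (m i) (swap_factor (real i) (s i))" for i
  define t where "t i = s i - quad_mid (real i) (m1 i) / quad_lead (real i) (m1 i)" for i
  define m2 where "m2 i = mul (real i) (m1 i) (swap_factor (real i) (t i))" for i
  define s2 where "s2 i = quad_const (real i) (m2 i) / (quad_lead (real i) (m2 i) * t i)" for i
  have "(\<lambda>i. rescale (real i) (m1 i)) \<longlonglongrightarrow> rescaled_mul 0 (1, 0, R, R - Q) (- 1, - 2, 4/\<tau>, 4/\<tau>)"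
    unfolding m1_def using s \<tau> by (intro rescale_mul_limit m swap_factor_limit_small) (simp_all add: \<tau>_def)
  also have "rescaled_mul 0 (1, 0, R, R - Q) (- 1, - 2, 4/\<tau>, 4/\<tau>) = (- 1, - 2, - R', - R' - Q)"
    by (simp add: rescaled_mul_def Let_def R'_def)
  finally have m1: "(\<lambda>i. rescale (real i) (m1 i)) \<longlonglongrightarrow> (- 1, - 2, - R', - R' - Q)" .
  have pos: "(- 1 - R')^2 = (1 + R')^2"
    unfolding power2_eq_square by (simp add: algebra_simps)
  have "(\<lambda>i. s i * (1/real i) - (quad_mid (real i) (m1 i) / real i) / quad_lead (real i) (m1 i))
      \<longlonglongrightarrow> (2*Q + 3) * 0 - 4 * (- 1) / (1 + (- 1 + - R')^2)"
    using den pos by (intro tendsto_intros s lim_1_over_n quadratic_limits[OF m1]) simp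
  then have t: "(\<lambda>i. t i / real i) \<longlonglongrightarrow> \<theta>"
    by (rule tendsto_large_index) (simp_all add: t_def \<theta>_def diff_divide_distrib pos)
  have "(\<lambda>i. rescale (real i) (m2 i)) \<longlonglongrightarrow> rescaled_mul 0 (- 1, - 2, - R', - R' - Q) (- 1, - 2, 0, - 2*\<theta>)"
    unfolding m2_def by (intro rescale_mul_limit m1 swap_factor_limit_large t \<theta>)
  also have "rescaled_mul 0 (- 1, - 2, - R', - R' - Q) (- 1, - 2, 0, - 2*\<theta>) = (1, 0, R', R' - (Q + 2*\<theta>))"
    by (simp add: rescaled_mul_def Let_def)
  finally have m2: "(\<lambda>i. rescale (real i) (m2 i)) \<longlonglongrightarrow> (1, 0, R', R' - (Q + 2*\<theta>))" .
  have "(\<lambda>i. (quad_const (real i) (m2 i) / real i) / (quad_lead (real i) (m2 i) * (t i / real i)))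
      \<longlonglongrightarrow> (8*(R' - (R' - (Q + 2*\<theta>))) + 12*(1 - 0)) / ((1 + (1 + R')^2) * \<theta>)"
    using den \<theta> by (intro tendsto_intros t quadratic_limits[OF m2]) simp
  then have s2: "s2 \<longlonglongrightarrow> 2*(Q + 2*\<theta>) + 3"
  proof (rule tendsto_large_index)
    have "(1 + (1 + R')^2) * \<theta> = 4"
      unfolding \<theta>_def times_divide_eq_right
      by (rule nonzero_mult_div_cancel_left[OF less_imp_neq[OF den, symmetric]])
    then show "(8*(R' - (R' - (Q + 2*\<theta>))) + 12*(1 - 0)) / ((1 + (1 + R')^2) * \<theta>) = 2*(Q + 2*\<theta>) + 3"
      by simp
  qed (simp add: s2_def)
  have "\<forall>\<^sub>F i in sequentially. t i / real i \<noteq> 0"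
    using t \<theta> by (rule tendsto_imp_eventually_ne)
  then have "\<forall>\<^sub>F i in sequentially. admissible (real i) (m2 i) (s2 i)"
    using ev eventually_ge_at_top[of 2]
  proof eventually_elim
    case (elim i)
    have n: "base_norm (real i) x \<noteq> 0" for x using base_norm_pos[of "real i" x] elim(3) by simp
    have "admissible (real i) (m1 i) (- s i)"
      unfolding m1_def using elim(2) n by (intro admissible_swap) auto
    then have "admissible (real i) (m1 i) (t i)"
      using admissible_other_root[of "real i" "m1 i" "- s i"] by (simp add: t_def)
    then have "admissible (real i) (m2 i) (- t i)"
      unfolding m2_def using n by (intro admissible_swap) auto
    then show ?case
      using admissible_root_product[of "real i" "m2 i" "- t i"] elim(1) by (simp add: s2_def)
  qed
  with m2 s2 show ?thesis unfolding step approximated_def by auto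
qed

lemma approximated_start: "approximated (0, 0)"
proof -
  have "admissible h (1, 0, 0, 0) 3" for h
    by (simp add: admissible_def residual_def Let_def algebra_simps power2_eq_square)
  then show ?thesis
    unfolding approximated_def by (intro exI[of _ "\<lambda>_. (1, 0, 0, 0)"] exI[of _ "\<lambda>_. 3"]) auto
qed

lemma approximated_iterate:
  "approximated ((limit_step ^^ k) (0, 0)) \<and> snd ((limit_step ^^ k) (0, 0)) \<ge> 0"
proof (induction k)
  case 0
  show ?case by (simp add: approximated_start)
next
  case (Suc k)
  obtain R Q where RQ: "(limit_step ^^ k) (0, 0) = (R, Q)" by fastforce
  show ?case
    using Suc approximated_step[of R Q] unfolding funpow.simps comp_apply RQ
    by (simp add: Let_def)
qed

lemma strict_mono_limit_parameter: "strict_mono (\<lambda>k. 2 * snd ((limit_step ^^ k) (0, 0)) + 3)"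
proof (rule strict_mono_Suc_iff[THEN iffD2, rule_format])
  fix k
  obtain R Q where RQ: "(limit_step ^^ k) (0, 0) = (R, Q)" by fastforce
  show "2 * snd ((limit_step ^^ k) (0, 0)) + 3 < 2 * snd ((limit_step ^^ Suc k) (0, 0)) + 3"
    unfolding funpow.simps comp_apply RQ by (simp add: Let_def add_pos_nonneg)
qed

text \<open>Different limits keep the finitely many values of \<open>t\<close> apart for large \<open>h\<close>.\<close>

lemma eventually_distinct_solutions:
  fixes n :: nat
  shows "\<exists>m t. \<forall>\<^sub>F i in sequentially. inj_on (\<lambda>k. t k i) {..<n} \<and> (\<forall>k<n. admissible (real i) (m k i) (t k i))"
proof -
  define \<tau> where "\<tau> k = 2 * snd ((limit_step ^^ k) (0, 0)) + 3" for k
  have "\<forall>k. \<exists>m t. (\<forall>\<^sub>F i in sequentially. admissible (real i) (m i) (t i)) \<and> t \<longlonglongrightarrow> \<tau> k"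
    using approximated_iterate unfolding approximated_def \<tau>_def by blast
  then obtain m t where ev: "\<forall>\<^sub>F i in sequentially. admissible (real i) (m k i) (t k i)"
    and lim: "t k \<longlonglongrightarrow> \<tau> k" for k
    by metis
  have "\<forall>\<^sub>F i in sequentially. t k i \<noteq> t l i" if "k \<noteq> l" for k l :: nat
  proof -
    have "(\<lambda>i. t k i - t l i) \<longlonglongrightarrow> \<tau> k - \<tau> l" by (intro tendsto_intros lim)
    moreover have "\<tau> k \<noteq> \<tau> l"
      using that strict_mono_eq[OF strict_mono_limit_parameter] unfolding \<tau>_def by blast
    ultimately have "\<forall>\<^sub>F i in sequentially. t k i - t l i \<noteq> 0"
      by (intro tendsto_imp_eventually_ne) auto
    then show ?thesis by eventually_elim simp
  qed
  then have distinct: "\<forall>\<^sub>F i in sequentially. k \<noteq> l \<longrightarrow> t k i \<noteq> t l i" for k l :: nat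
    by (cases "k = l") auto
  have "\<forall>\<^sub>F i in sequentially. \<forall>k\<in>{..<n}. \<forall>l\<in>{..<n}. k \<noteq> l \<longrightarrow> t k i \<noteq> t l i"
    by (intro eventually_ball_finite finite_lessThan ballI distinct)
  moreover have "\<forall>\<^sub>F i in sequentially. \<forall>k\<in>{..<n}. admissible (real i) (m k i) (t k i)"
    by (intro eventually_ball_finite finite_lessThan ballI ev)
  ultimately have "\<forall>\<^sub>F i in sequentially. inj_on (\<lambda>k. t k i) {..<n} \<and> (\<forall>k<n. admissible (real i) (m k i) (t k i))"
    by eventually_elim (auto simp: inj_on_def)
  then show ?thesis by blast
qed

section \<open>Integer solutions\<close>

lemma common_denominator:
  fixes xs :: "real list"
  shows "\<forall>x\<in>set xs. x \<in> \<rat> \<Longrightarrow> \<exists>d::int. d > 0 \<and> (\<forall>x\<in>set xs. of_int d * x \<in> \<int>)"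
proof (induction xs)
  case Nil
  show ?case by (rule exI[of _ 1]) simp
next
  case (Cons x xs)
  then obtain d :: int where d: "d > 0" "\<forall>x\<in>set xs. of_int d * x \<in> \<int>" by auto
  obtain a b :: int where x: "b > 0" "x = of_int a / of_int b"
    using Cons.prems by (auto elim: Rats_cases')
  have "real_of_int (d * b) * x = of_int (d * a)" using x by simp
  then have "real_of_int (d * b) * x \<in> \<int>" by (metis Ints_of_int)
  moreover have "real_of_int (d * b) * y \<in> \<int>" if "y \<in> set xs" for y
  proof -
    have "real_of_int (d * b) * y = of_int b * (of_int d * y)" by simp
    also have "\<dots> \<in> \<int>" by (rule Ints_mult[OF Ints_of_int bspec[OF d(2) that]])
    finally show ?thesis .
  qed
  ultimately show ?case using d(1) x(1) by (intro exI[of _ "d * b"]) simp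
qed

lemma F_form_of_int:
  "F_form (of_int p) (of_int q) (of_int x1) (of_int x2) (of_int x3) (of_int x4)
   = (of_int (F_form p q x1 x2 x3 x4) :: real)"
  by (simp add: F_form_def)

lemma adj_mat_of_int: "adj_mat (map_mat real_of_int A) = map_mat of_int (adj_mat A)"
proof -
  have "mat_delete (map_mat real_of_int A) i j = map_mat of_int (mat_delete A i j)" for i j
    by (rule eq_matI) (auto simp: mat_delete_def)
  then show ?thesis
    by (intro eq_matI) (auto simp: adj_mat_def cofactor_def)
qed

lemma G_forms_of_int:
  assumes "j < 4"
  shows "G_forms (of_int p) (of_int q) (of_int x1) (of_int x2) (of_int x3) (of_int x4)
           (of_int x5) (of_int x6) (of_int x7) (of_int x8) $ j
    = real_of_int (G_forms p q x1 x2 x3 x4 x5 x6 x7 x8 $ j)"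
proof -
  let ?A = "A_mat p q x1 x2 x3 x4" and ?v = "vec_of_list [x5, x6, x7, x8]"
  have A: "A_mat (of_int p) (of_int q) (of_int x1) (of_int x2) (of_int x3) (of_int x4)
      = map_mat real_of_int ?A"
    by (rule eq_matI) (auto simp: A_mat_def mat_of_rows_list_def less_Suc_eq numeral_eq_Suc)
  have v: "vec_of_list [of_int x5, of_int x6, of_int x7, of_int x8] = map_vec real_of_int ?v"
    by (rule eq_vecI) (auto simp: less_Suc_eq)
  have dim: "adj_mat ?A \<in> carrier_mat 4 4" "?v \<in> carrier_vec 4"
    by (auto simp: adj_mat_def A_mat_def mat_of_rows_list_def intro: carrier_vecI)
  show ?thesis
    using assms dim(1)
    unfolding G_forms_def A v adj_mat_of_int of_int_hom.mult_mat_vec_hom[OF dim, symmetric]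
    by simp
qed

lemma Phi_of_int:
  "Phi (of_int h) (of_int x1) (of_int x2) (of_int x3) (of_int x4)
     (of_int x5) (of_int x6) (of_int x7) (of_int x8)
   = real_of_int (Phi h x1 x2 x3 x4 x5 x6 x7 x8)"
proof -
  have h: "real_of_int h + 3 = of_int (h + 3)" "real_of_int h + 4 = of_int (h + 4)" by simp_all
  have H: "H_form (of_int p) (of_int q) (of_int x1) (of_int x2) (of_int x3) (of_int x4)
      (of_int x5) (of_int x6) (of_int x7) (of_int x8)
      = real_of_int (H_form p q x1 x2 x3 x4 x5 x6 x7 x8)" for p q
    by (simp add: H_form_def Let_def G_forms_of_int)
  show ?thesis
    unfolding Phi_def Let_def h F_form_of_int H by simp
qed

text \<open>Homogeneity clears denominators. The vector \<open>y\<close> is nonzero because its norm equals that of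
\<open>t + f \<rho>\<close>, which is positive.\<close>

lemma admissible_integral:
  assumes admissible: "admissible (real i) m t" and i: "i \<ge> 2"
  shows "\<exists>x1 x2 x5 x6 x7 x8. x2 > 0 \<and> real_of_int x1 = t * of_int x2 \<and>
    Phi (int i) x1 x2 0 x2 x5 x6 x7 x8 = 0 \<and> (x5, x6, x7, x8) \<noteq> (0, 0, 0, 0)"
proof -
  let ?h = "real i"
  obtain a b c e where y: "mul ?h m (t, 0, 0, 1) = (a, b, c, e)"
    by (cases "mul ?h m (t, 0, 0, 1)") auto
  have rat: "rational (a, b, c, e)" "t \<in> \<rat>"
    using admissible rational_mul[of ?h m "(t, 0, 0, 1)"] unfolding admissible_def y by auto
  have Phi: "Phi ?h t 1 0 1 (a + b) (c + e) b e = 0"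
    and F: "F_form (?h + 3) (?h + 4) (a + b) (c + e) b e = base_norm ?h t"
    using admissible unfolding admissible_def y by (auto intro: Phi_zero[OF _ y])
  have "\<forall>x\<in>set [t, a + b, c + e, b, e]. x \<in> \<rat>" using rat by simp
  then obtain d :: int where d: "d > 0"
    "\<forall>x\<in>set [t, a + b, c + e, b, e]. of_int d * x \<in> \<int>"
    using common_denominator by blast
  then obtain x1 x5 x6 x7 x8 where x: "of_int d * t = of_int x1" "of_int d * (a + b) = of_int x5"
    "of_int d * (c + e) = of_int x6" "of_int d * b = of_int x7" "of_int d * e = of_int x8"
    by (auto elim!: Ints_cases)
  have "real_of_int (Phi (int i) x1 d 0 d x5 x6 x7 x8)
      = Phi ?h (of_int d * t) (of_int d * 1) (of_int d * 0) (of_int d * 1)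
          (of_int d * (a + b)) (of_int d * (c + e)) (of_int d * b) (of_int d * e)"
    unfolding x Phi_of_int[symmetric] by simp
  also have "\<dots> = 0" unfolding Phi_scale Phi by simp
  finally have "Phi (int i) x1 d 0 d x5 x6 x7 x8 = 0" by simp
  moreover have "(x5, x6, x7, x8) \<noteq> (0, 0, 0, 0)"
  proof
    assume "(x5, x6, x7, x8) = (0, 0, 0, 0)"
    then have "a + b = 0" "c + e = 0" "b = 0" "e = 0" using x d(1) by auto
    then have "base_norm ?h t = 0" using F by (simp add: F_form_def)
    then show False using base_norm_pos[of ?h t] i by simp
  qed
  ultimately show ?thesis using d(1) x(1) by (metis mult.commute)
qed

lemma at_least_distinctI:
  assumes "\<And>k. k < n \<Longrightarrow> f k \<in> X"
    and "\<And>k l. k < n \<Longrightarrow> l < n \<Longrightarrow> k \<noteq> l \<Longrightarrow> \<not> proportional (f k) (f l)"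
  shows "at_least_distinct n X"
proof -
  have "proportional xs xs" for xs
    unfolding proportional_def by (intro exI[of _ 1]) simp
  then have "inj_on f {..<n}" using assms(2) by (metis inj_onI lessThan_iff)
  then show ?thesis
    unfolding at_least_distinct_def using assms
    by (intro exI[of _ "f ` {..<n}"]) (auto simp: card_image pairwise_def)
qed

lemma proportional_ratio:
  assumes "proportional (x1 # x2 # xs) (y1 # y2 # ys)"
  shows "x1 * y2 = y1 * x2"
proof -
  obtain c :: rat where "of_int y1 = c * of_int x1" "of_int y2 = c * of_int x2"
    using assms unfolding proportional_def by auto
  then have "rat_of_int (x1 * y2) = rat_of_int (y1 * x2)" by simp
  then show ?thesis by (simp only: of_int_eq_iff)
qed

lemma eventually_at_least_distinct:
  "\<forall>\<^sub>F i in sequentially. at_least_distinct n (system_solutions (int i)) \<and>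
     at_least_distinct n (single_eq_solutions (int i))"
proof -
  obtain m t where "\<forall>\<^sub>F i in sequentially.
      inj_on (\<lambda>k. t k i) {..<n} \<and> (\<forall>k<n. admissible (real i) (m k i) (t k i))"
    using eventually_distinct_solutions by blast
  then show ?thesis
    using eventually_ge_at_top[of 2]
  proof eventually_elim
    case (elim i)
    then have "\<forall>k. \<exists>x1 x2 x5 x6 x7 x8. k < n \<longrightarrow> x2 > 0 \<and> real_of_int x1 = t k i * of_int x2 \<and>
        Phi (int i) x1 x2 0 x2 x5 x6 x7 x8 = 0 \<and> (x5, x6, x7, x8) \<noteq> (0, 0, 0, 0)"
      using admissible_integral by meson
    then obtain x1 x2 x5 x6 x7 x8 where x: "x2 k > 0" "real_of_int (x1 k) = t k i * of_int (x2 k)"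
      "Phi (int i) (x1 k) (x2 k) 0 (x2 k) (x5 k) (x6 k) (x7 k) (x8 k) = 0"
      "(x5 k, x6 k, x7 k, x8 k) \<noteq> (0, 0, 0, 0)" if "k < n" for k
      by metis
    have indep: "\<not> proportional (x1 k # x2 k # xs) (x1 l # x2 l # ys)"
      if "k < n" "l < n" "k \<noteq> l" for k l xs ys
    proof
      assume "proportional (x1 k # x2 k # xs) (x1 l # x2 l # ys)"
      then have "real_of_int (x1 k) * of_int (x2 l) = of_int (x1 l) * of_int (x2 k)"
        using proportional_ratio by (metis of_int_mult)
      then have "t k i = t l i" using x(1,2)[OF that(1)] x(1,2)[OF that(2)] by simp
      then show False using elim(1) that by (auto simp: inj_on_def)
    qed
    have "at_least_distinct n (system_solutions (int i))"
    proof (rule at_least_distinctI)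
      fix k assume "k < n"
      then show "[x1 k, x2 k, 0, x2 k, x5 k, x6 k, x7 k, x8 k] \<in> system_solutions (int i)"
        using x[of k] unfolding system_solutions_def by auto
    qed (rule indep)
    moreover have "at_least_distinct n (single_eq_solutions (int i))"
    proof (rule at_least_distinctI)
      fix k assume "k < n"
      then show "[x1 k, x2 k, x5 k, x6 k, x7 k, x8 k] \<in> single_eq_solutions (int i)"
        using x[of k] unfolding single_eq_solutions_def by auto
    qed (rule indep)
    ultimately show ?case by blast
  qed
qed

lemma infinite_int_if_eventually:
  assumes "\<forall>\<^sub>F i in sequentially. P (int i)"
  shows "infinite {h::int. P h}"
proof -
  obtain N where "\<And>i. i \<ge> N \<Longrightarrow> P (int i)" using assms by (auto simp: eventually_sequentially)
  then have "int ` {N..} \<subseteq> {h. P h}" by auto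
  moreover have "infinite (int ` {N..})" by (simp add: finite_image_iff infinite_Ici)
  ultimately show ?thesis by (rule infinite_super)
qed

theorem mainTheorem8:
  shows "(\<forall>n::nat. n > 0 \<longrightarrow> infinite {h::int. at_least_distinct n (system_solutions h)}) \<and>
         (\<forall>n::nat. n > 0 \<longrightarrow> infinite {h::int. at_least_distinct n (single_eq_solutions h)})"
proof (intro conjI allI impI infinite_int_if_eventually)
  fix n :: nat
  show "\<forall>\<^sub>F i in sequentially. at_least_distinct n (system_solutions (int i))"
    using eventually_at_least_distinct[of n] by eventually_elim simp
  show "\<forall>\<^sub>F i in sequentially. at_least_distinct n (single_eq_solutions (int i))"
    using eventually_at_least_distinct[of n] by eventually_elim simp
qed

end
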